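(* Let $b>0$ and $$A_0=\begin{pmatrix}-1&2b\\0&-1\end{pmatrix},\qquad A_1=\begin{pmatrix}-1&0\\2b&-1\end{pmatrix}.$$ Let $\chi(\beta)$, $\beta>0$, be the growth exponent of the associated randomly switched system with $\lambda=1/2$, defined in the context. If $b>1$, then there exists $\beta_c\in(0,+\infty)$ such that $\chi$ is negative on $(0,\beta_c)$ and positive on $(\beta_c,+\infty)$.
   Context: Let $e_\theta=(\cos\theta,\sin\theta)$, $\mathbb{T}=\mathbb{R}/2\pi\mathbb{Z}$, and, for $i\in\{0,1\}$, $d_i(\theta)=\langle A_ie_\theta,e_{\theta+\pi/2}\rangle$ and $\mathcal{A}(\theta,i)=\langle A_ie_\theta,e_\theta\rangle$. The angular process is the Markov process $(\Theta,I)$ on $\mathbb{T}\times\{0,1\}$ with generator $L_\beta f(\theta,i)=d_i(\theta)\partial_\theta f(\theta,i)+\frac{\beta}{2}(f(\theta,1-i)-f(\theta,i))$: $I$ jumps from $i$ to $1-i$ at rate $\beta/2$, and $\dot\Theta_t=d_{I_t}(\Theta_t)$. It is the angular part of the process $(X,I)$ with $\dot X_t=A_{I_t}X_t$, $X_0\neq0$. It has two recurrent classes, $\{\theta\in(0,\pi/2)\}\times\{0,1\}$ and $\{\theta\in(\pi,3\pi/2)\}\times\{0,1\}$; let $\mu_\beta$ be the ergodic invariant probability measure carried by the first one (the other is its image under $\theta\mapsto\theta+\pi$). Then $\chi(\beta)=\int\mathcal{A}(\theta,i)\,d\mu_\beta(\theta,i)$, which is the almost sure limit of $\frac1t\log\|X_t\|$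 as $t\to\infty$ (for any $X_0\ne0$). *)

theory Defs
  imports "HOL-Probability.Probability"
begin

subsection \<open>The switched linear system\<close>

definition switch_matrix :: "real \<Rightarrow> nat \<Rightarrow> real^2^2" where
  "switch_matrix b i = (if i = 0 then vector [vector [-1, 2 * b], vector [0, -1]]
                       else vector [vector [-1, 0], vector [2 * b, -1]])"

definition unit_vec :: "real \<Rightarrow> real^2" where
  "unit_vec \<theta> = vector [cos \<theta>, sin \<theta>]"

definition angular_rate :: "real \<Rightarrow> nat \<Rightarrow> real \<Rightarrow> real" where
  "angular_rate b i \<theta> = (switch_matrix b i *v unit_vec \<theta>) \<bullet> unit_vec (\<theta> + pi / 2)"

definition radial_rate :: "real \<Rightarrow> real \<times> nat \<Rightarrow> real" where
  "radial_rate b = (\<lambda>(\<theta>, i). (switch_matrix b i *v unit_vec \<theta>) \<bullet> unit_vec \<theta>)"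


subsection \<open>The angular process\<close>

text \<open>The circle \<open>\<real> / 2\<pi>\<int>\<close> is represented by its fundamental domain \<open>[0, 2\<pi>)\<close>, whose Borel
  sets are those of the circle. Regularity of a function on the circle is that of its
  \<open>2\<pi>\<close>-periodic version on the line, not of its restriction to \<open>[0, 2\<pi>)\<close>.\<close>

definition state_space :: "(real \<times> nat) measure" where
  "state_space = restrict_space borel {0..<2 * pi} \<Otimes>\<^sub>M count_space {0, 1}"

definition C1_circle :: "(real \<times> nat \<Rightarrow> real) set" where
  "C1_circle = {f. \<forall>i\<in>{0, 1}. (\<forall>\<theta>. f (\<theta> + 2 * pi, i) = f (\<theta>, i)) \<and>
                               (\<lambda>\<theta>. f (\<theta>, i)) C1_differentiable_on UNIV}"

definition gen_L :: "real \<Rightarrow> real \<Rightarrow> (real \<times> nat \<Rightarrow> real) \<Rightarrow> real \<times> nat \<Rightarrow> real" where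
  "gen_L b \<beta> f = (\<lambda>(\<theta>, i). angular_rate b i \<theta> * deriv (\<lambda>s. f (s, i)) \<theta>
                        + \<beta> / 2 * (f (\<theta>, 1 - i) - f (\<theta>, i)))"

definition markov_semigroup :: "'a measure \<Rightarrow> (real \<Rightarrow> 'a \<Rightarrow> 'a measure) \<Rightarrow> bool" where
  "markov_semigroup S P \<longleftrightarrow>
     (\<forall>t\<ge>0. P t \<in> S \<rightarrow>\<^sub>M prob_algebra S) \<and>
     (\<forall>x\<in>space S. P 0 x = return S x) \<and>
     (\<forall>s\<ge>0. \<forall>t\<ge>0. \<forall>x\<in>space S. P (s + t) x = P s x \<bind> P t)"

text \<open>The generator is the derivative at time 0 of the transition semigroup, in the supremum norm.
  It is prescribed on the \<open>C\<^sup>1\<close> functions; these are a core, so that \<open>b\<close> and \<open>\<beta>\<close>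
  determine the kernels \<open>P t x\<close> for \<open>t \<ge> 0\<close> and \<open>x\<close> in the state space.\<close>

definition angular_process :: "real \<Rightarrow> real \<Rightarrow> (real \<Rightarrow> real \<times> nat \<Rightarrow> (real \<times> nat) measure) \<Rightarrow> bool"
  where
  "angular_process b \<beta> P \<longleftrightarrow>
     markov_semigroup state_space P \<and>
     (\<forall>f\<in>C1_circle. uniform_limit (space state_space)
        (\<lambda>t x. ((\<integral>y. f y \<partial>P t x) - f x) / t) (gen_L b \<beta> f) (at_right 0))"


subsection \<open>Invariant measures and the growth exponent\<close>

definition invariant_prob :: "'a measure \<Rightarrow> (real \<Rightarrow> 'a \<Rightarrow> 'a measure) \<Rightarrow> 'a measure \<Rightarrow> bool" where
  "invariant_prob S P \<mu> \<longleftrightarrow> \<mu> \<in> space (prob_algebra S) \<and> (\<forall>t\<ge>0. \<mu> \<bind> P t = \<mu>)"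

definition ergodic_prob :: "'a measure \<Rightarrow> (real \<Rightarrow> 'a \<Rightarrow> 'a measure) \<Rightarrow> 'a measure \<Rightarrow> bool" where
  "ergodic_prob S P \<mu> \<longleftrightarrow> invariant_prob S P \<mu> \<and>
     (\<forall>B\<in>sets S. (\<forall>t\<ge>0. AE x in \<mu>. measure (P t x) B = indicator B x) \<longrightarrow>
        measure \<mu> B = 0 \<or> measure \<mu> B = 1)"

definition first_class :: "(real \<times> nat) set" where
  "first_class = {0<..<pi / 2} \<times> {0, 1}"

definition growth_exponent :: "real \<Rightarrow> (real \<times> nat) measure \<Rightarrow> real" where
  "growth_exponent b \<mu> = (\<integral>x. radial_rate b x \<partial>\<mu>)"

end

theory Submission
  imports Defs "HOL-Real_Asymp.Real_Asymp"
begin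

text \<open>In the coordinate \<open>y = cos 2\<theta>\<close> on the first quadrant put \<open>s = sin 2\<theta> = \<surd>(1 - y\<^sup>2)\<close> and
  \<open>\<kappa> = \<beta> / (2b)\<close>. The \<open>y\<close>-marginal of the invariant measure has a density proportional to
  \<open>s\<^sup>-\<^sup>3 exp (-\<kappa>/s)\<close>: for \<open>w\<close> supported inside \<open>(-1, 1)\<close> and centred for this density, the equation
  \<open>L f = w (cos 2\<theta>)\<close> has a solution \<open>f (\<theta>, i) = F\<^sub>i (cos 2\<theta>)\<close> that is \<open>C\<^sup>1\<close> on the whole circle,
  and \<open>L f\<close> integrates to 0. Since the radial rate is \<open>-1 + b sin 2\<theta>\<close>, the exponent is
  \<open>-1 + b m(\<kappa>)\<close> where \<open>m(\<kappa>)\<close> is the mean of \<open>s\<close> (a quotient \<open>K\<^sub>0 / K\<^sub>1\<close> of Bessel functions).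
  Passing from \<open>\<kappa>\<close> to \<open>\<kappa>' > \<kappa>\<close> multiplies the density by the increasing function
  \<open>exp (-(\<kappa>' - \<kappa>)/s)\<close> of \<open>s\<close>, so \<open>m\<close> is strictly increasing by Chebyshev's inequality; moreover
  \<open>m\<close> tends to 0 at 0 and to 1 at infinity, so it crosses the level \<open>1/b\<close>.\<close>

subsection \<open>The mean of \<open>sin 2\<theta>\<close> as a function of the jump rate\<close>

text \<open>\<open>sqrt\<close> is odd on the real line, so \<open>semi\<close> is negative outside
  [-1, 1] and its sign alone tells whether y lies in (-1, 1).\<close>

definition semi :: "real \<Rightarrow> real" where
  "semi y = sqrt (1 - y\<^sup>2)"

definition kern :: "real \<Rightarrow> nat \<Rightarrow> real \<Rightarrow> real" where
  "kern \<kappa> j y = (if semi y \<le> 0 then 0 else exp (- \<kappa> / semi y) / semi y ^ j)"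

text \<open>The substitution y = tanh u turns \<open>moment \<kappa> 2\<close> and
  \<open>moment \<kappa> 3\<close> into 2 K_0(\<kappa>) and 2 K_1(\<kappa>), with K_0 and K_1
  modified Bessel functions.\<close>

definition moment :: "real \<Rightarrow> nat \<Rightarrow> real" where
  "moment \<kappa> j = integral {-1..1} (kern \<kappa> j)"

lemma semi_pos_iff: "semi y > 0 \<longleftrightarrow> \<bar>y\<bar> < 1"
  by (simp add: semi_def abs_square_less_1)

lemma semi_le_1: "semi y \<le> 1"
  by (simp add: semi_def)

lemma semi_nonneg: "\<bar>y\<bar> \<le> 1 \<Longrightarrow> semi y \<ge> 0"
  by (simp add: semi_def abs_square_le_1)

lemma semi_squared: "\<bar>y\<bar> \<le> 1 \<Longrightarrow> (semi y)\<^sup>2 = 1 - y\<^sup>2"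
  by (simp add: semi_def abs_square_le_1)

lemma continuous_semi [continuous_intros]:
  "continuous_on A f \<Longrightarrow> continuous_on A (\<lambda>x. semi (f x))"
  unfolding semi_def by (intro continuous_intros)

lemma semi_has_real_derivative:
  assumes "\<bar>y\<bar> < 1"
  shows "(semi has_real_derivative - y / semi y) (at y)"
proof -
  have "1 - y\<^sup>2 > 0" using assms by (simp add: abs_square_less_1)
  then show ?thesis
    unfolding semi_def[abs_def]
    by (auto intro!: derivative_eq_intros simp: field_simps)
qed

lemma kern_nonneg: "kern \<kappa> j y \<ge> 0"
  by (simp add: kern_def)

lemma kern_pos: "\<bar>y\<bar> < 1 \<Longrightarrow> kern \<kappa> j y > 0"
  using semi_pos_iff[of y] by (simp add: kern_def)

lemma semi_mult_kern: "semi y * kern \<kappa> (Suc j) y = kern \<kappa> j y"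
  by (simp add: kern_def)

text \<open>The weight is a function of s = \<open>semi y\<close> alone. As s decreases to 0 the
  factor exp(-\<kappa>/s) beats every power of 1/s, so extending by 0 gives a continuous profile on
  the whole line.\<close>

lemma continuous_kern:
  assumes "\<kappa> > 0"
  shows "continuous_on A (kern \<kappa> j)"
proof -
  let ?h = "\<lambda>s::real. if s \<le> 0 then 0 else exp (- \<kappa> / s) / s ^ j"
  have "isCont ?h s" for s
  proof -
    consider "s > 0" | "s < 0" | "s = 0" by linarith
    then show ?thesis
    proof cases
      case 1
      then have "\<forall>\<^sub>F x in nhds s. ?h x = exp (- \<kappa> / x) / x ^ j"
        using eventually_nhds_in_open[of "{0<..}" s] by (auto elim: eventually_mono)
      then show ?thesis
        using 1 by (subst isCont_cong) (auto intro!: continuous_intros)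
    next
      case 2
      then have "\<forall>\<^sub>F x in nhds s. ?h x = 0"
        using eventually_nhds_in_open[of "{..<0}" s] by (auto elim: eventually_mono)
      then show ?thesis
        by (subst isCont_cong) auto
    next
      case 3
      have "((\<lambda>s. exp (- \<kappa> / s) / s ^ j) \<longlongrightarrow> 0) (at_right 0)"
        using assms by real_asymp
      then have "(?h \<longlongrightarrow> 0) (at_right 0)"
        by (rule Lim_transform_eventually)
          (use eventually_at_right_less[of 0] in \<open>auto elim: eventually_mono\<close>)
      moreover have "(?h \<longlongrightarrow> 0) (at_left 0)"
        by (rule tendsto_eventually) (auto simp: eventually_at_filter)
      ultimately show ?thesis
        using 3 by (simp add: isCont_def filterlim_at_split)
    qed
  qed
  then have "continuous_on UNIV ?h" by (intro continuous_at_imp_continuous_on) simp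
  then have "continuous_on A (\<lambda>y. ?h (semi y))"
    by (rule continuous_on_compose2) (auto intro!: continuous_intros)
  then show ?thesis by (simp add: kern_def[abs_def])
qed

lemma integrable_kern: "\<kappa> > 0 \<Longrightarrow> kern \<kappa> j integrable_on {a..b}"
  by (intro integrable_continuous_real continuous_kern)

lemma has_integral_kern: "\<kappa> > 0 \<Longrightarrow> (kern \<kappa> j has_integral moment \<kappa> j) {-1..1}"
  unfolding moment_def by (intro integrable_integral integrable_kern)

lemma moment_pos:
  assumes "\<kappa> > 0"
  shows "moment \<kappa> j > 0"
proof -
  have "integral {-1..1::real} (\<lambda>_. 0) < integral {-1..1} (kern \<kappa> j)"
    by (rule integral_less_real) (use assms in \<open>auto intro: continuous_kern kern_pos\<close>)
  then show ?thesis by (simp add: moment_def)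
qed

lemma moment_mono:
  assumes "\<kappa> > 0" "i \<le> j"
  shows "moment \<kappa> i \<le> moment \<kappa> j"
  unfolding moment_def
proof (rule integral_le)
  fix y
  have "semi y ^ j \<le> semi y ^ i" if "semi y > 0"
    using that semi_le_1 assms(2) by (intro power_decreasing) auto
  then show "kern \<kappa> i y \<le> kern \<kappa> j y"
    by (auto simp: kern_def intro!: divide_left_mono)
qed (use assms in \<open>auto intro: integrable_kern\<close>)

lemma moment_antimono:
  assumes "\<kappa> > 0" "\<kappa> \<le> \<kappa>'"
  shows "moment \<kappa>' j \<le> moment \<kappa> j"
  unfolding moment_def
  by (rule integral_le)
    (use assms in \<open>auto intro!: integrable_kern divide_right_mono simp: kern_def divide_right_mono\<close>)

text \<open>Integration of the derivative of \<open>y exp (-\<kappa> / semi y)\<close> over \<open>[-1, 1]\<close>.\<close>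

lemma moment_recurrence:
  assumes "\<kappa> > 0"
  shows "\<kappa> * moment \<kappa> 3 = moment \<kappa> 0 + \<kappa> * moment \<kappa> 1"
proof -
  let ?Y = "\<lambda>y. y * kern \<kappa> 0 y" and ?d = "\<lambda>y. kern \<kappa> 0 y - \<kappa> * kern \<kappa> 3 y + \<kappa> * kern \<kappa> 1 y"
  have "(?Y has_vector_derivative ?d y) (at y)" if y: "y \<in> {-1<..<1}" for y
  proof -
    have s: "semi y > 0" "(semi y)\<^sup>2 = 1 - y\<^sup>2"
      using y by (auto simp: semi_pos_iff semi_squared)
    have ev: "\<forall>\<^sub>F x in nhds y. x * exp (- \<kappa> / semi x) = ?Y x"
    proof (rule eventually_mono)
      show "\<forall>\<^sub>F x in nhds y. x \<in> {-1<..<1}" using y by (intro eventually_nhds_in_open) auto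
      fix x :: real assume "x \<in> {-1<..<1}"
      then have "semi x > 0" by (simp add: semi_pos_iff abs_less_iff)
      then show "x * exp (- \<kappa> / semi x) = ?Y x" by (simp add: kern_def)
    qed
    have e: "exp (- \<kappa> / semi y) * 1 + y * (exp (- \<kappa> / semi y) * (\<kappa> * (- y / semi y) / (semi y)\<^sup>2)) = ?d y"
    proof -
      have "y * y = 1 - semi y * semi y" using s(2) by (simp add: power2_eq_square)
      have "y * (\<kappa> * (- y / semi y) / (semi y)\<^sup>2) = - \<kappa> * (y * y) / semi y ^ 3"
        by (simp add: power2_eq_square power3_eq_cube mult_ac)
      also have "\<dots> = - \<kappa> / semi y ^ 3 + \<kappa> / semi y"
        unfolding \<open>y * y = _\<close> using s(1) by (simp add: field_simps power3_eq_cube)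
      finally have "exp (- \<kappa> / semi y) * (y * (\<kappa> * (- y / semi y) / (semi y)\<^sup>2))
          = exp (- \<kappa> / semi y) * (- \<kappa> / semi y ^ 3 + \<kappa> / semi y)" by simp
      then show ?thesis using s(1) by (simp add: kern_def algebra_simps)
    qed
    have "((\<lambda>x. x * exp (- \<kappa> / semi x)) has_real_derivative ?d y) (at y)"
      using s(1) unfolding e[symmetric]
      by (auto intro!: derivative_eq_intros semi_has_real_derivative simp: semi_pos_iff[symmetric] power2_eq_square)
    then have "(?Y has_real_derivative ?d y) (at y)"
      using DERIV_cong_ev[OF refl ev refl] by simp
    then show ?thesis by (simp add: has_real_derivative_iff_has_vector_derivative)
  qed
  \<comment> \<open>\<open>?Y\<close> is differentiable only in the interior but continuous up to
    the endpoints, where \<open>kern\<close> vanishes; hence both boundary terms are 0.\<close>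
  then have "(?d has_integral (?Y 1 - ?Y (-1))) {-1..1}"
    using assms
    by (intro fundamental_theorem_of_calculus_interior) (auto intro!: continuous_intros continuous_kern)
  then have "integral {-1..1} ?d = 0"
    by (auto simp: kern_def semi_def dest!: integral_unique)
  moreover have "integral {-1..1} ?d = moment \<kappa> 0 - \<kappa> * moment \<kappa> 3 + \<kappa> * moment \<kappa> 1"
    using assms
    by (intro integral_unique has_integral_diff has_integral_add has_integral_mult_right has_integral_kern)
  ultimately show ?thesis by simp
qed

section \<open>Bounds, strict monotonicity and level crossing of the mean\<close>

definition mean_semi :: "real \<Rightarrow> real" where
  "mean_semi \<kappa> = moment \<kappa> 2 / moment \<kappa> 3"

text \<open>In the recurrence the moments of order 0 and 1 are at most the one of order 2, because
  \<open>semi\<close> is at most 1.\<close>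

lemma mean_semi_ge:
  assumes "\<kappa> > 0"
  shows "mean_semi \<kappa> \<ge> \<kappa> / (\<kappa> + 1)"
proof -
  have "\<kappa> * moment \<kappa> 3 \<le> moment \<kappa> 2 + \<kappa> * moment \<kappa> 2"
    using moment_recurrence[OF assms] moment_mono[OF assms, of 0 2] moment_mono[OF assms, of 1 2] assms
    by (simp add: add_mono)
  then show ?thesis
    using assms moment_pos[OF assms, of 3] by (simp add: mean_semi_def field_simps)
qed

text \<open>The free parameter A cuts the integral at s = 1/A: below it one factor s is traded for
  1/A, above it the weight is at most A^2. Since \<open>moment \<kappa> 3\<close> grows at least
  like 1/\<kappa>, choosing A large and then \<kappa> small makes the bound arbitrarily
  small.\<close>

lemma mean_semi_le:
  assumes \<kappa>: "0 < \<kappa>" "\<kappa> \<le> 1" and A: "A > 0"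
  shows "mean_semi \<kappa> \<le> 1 / A + 2 * A\<^sup>2 * \<kappa> / moment 1 0"
proof -
  have "kern \<kappa> 2 y \<le> kern \<kappa> 3 y / A + A\<^sup>2" for y
  proof (cases "semi y \<le> 1 / A")
    case True
    then have "semi y * kern \<kappa> 3 y \<le> 1 / A * kern \<kappa> 3 y"
      by (intro mult_right_mono kern_nonneg)
    then show ?thesis
      using semi_mult_kern[of y \<kappa> 2] by (simp add: numeral_3_eq_3 numeral_2_eq_2 add_increasing2)
  next
    case False
    then have "1 / A < semi y" "0 < 1 / A" using A by auto
    then have s: "semi y > 0" by linarith
    then have "1 / semi y \<le> A" using \<open>1 / A < semi y\<close> A by (simp add: field_simps)
    have "kern \<kappa> 2 y \<le> (1 / semi y)\<^sup>2"
      using s \<kappa> by (simp add: kern_def power_divide divide_right_mono)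
    also have "\<dots> \<le> A\<^sup>2" using s \<open>1 / semi y \<le> A\<close> by (intro power_mono) auto
    finally show ?thesis using kern_nonneg[of \<kappa> 3 y] A by (simp add: add_increasing)
  qed
  then have "moment \<kappa> 2 \<le> integral {-1..1} (\<lambda>y. kern \<kappa> 3 y / A + A\<^sup>2)"
    unfolding moment_def using \<kappa>
    by (intro integral_le integrable_kern integrable_continuous_real continuous_intros continuous_kern) (use A in auto)
  also have "\<dots> = moment \<kappa> 3 / A + 2 * A\<^sup>2"
    unfolding moment_def using integrable_kern[OF \<kappa>(1), of 3 "-1" 1]
    by (subst integral_add) (auto intro: integrable_on_divide)
  finally have "mean_semi \<kappa> \<le> 1 / A + 2 * A\<^sup>2 / moment \<kappa> 3"
    using moment_pos[OF \<kappa>(1), of 3] A by (simp add: mean_semi_def field_simps)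
  also have "2 * A\<^sup>2 / moment \<kappa> 3 \<le> 2 * A\<^sup>2 * \<kappa> / moment 1 0"
  proof -
    \<comment> \<open>The recurrence gives \<open>moment \<kappa> 0\<close> as a lower bound, and
      lowering the parameter from 1 to \<kappa> can only increase this moment.\<close>
    have "moment 1 0 \<le> \<kappa> * moment \<kappa> 3"
      using moment_recurrence[OF \<kappa>(1)] moment_antimono[OF \<kappa>, of 0] moment_pos[OF \<kappa>(1), of 1] \<kappa>
      by (smt (verit) mult_pos_pos)
    then have "2 * A\<^sup>2 * moment 1 0 \<le> 2 * A\<^sup>2 * (\<kappa> * moment \<kappa> 3)"
      by (intro mult_left_mono) auto
    then show ?thesis
      using moment_pos[OF \<kappa>(1), of 3] moment_pos[of 1 0] by (simp add: field_simps)
  qed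
  finally show ?thesis by simp
qed

lemma mean_semi_strict_mono:
  assumes "0 < \<kappa>" "\<kappa> < \<kappa>'"
  shows "mean_semi \<kappa> < mean_semi \<kappa>'"
proof -
  define c \<delta> where "c = mean_semi \<kappa>" and "\<delta> = \<kappa>' - \<kappa>"
  have pos: "moment \<kappa> 2 > 0" "moment \<kappa> 3 > 0" "moment \<kappa>' 3 > 0" and \<kappa>': "\<kappa>' > 0"
    using assms by (auto intro: moment_pos)
  have c: "c > 0" using pos by (simp add: c_def mean_semi_def)
  have \<delta>: "\<delta> > 0" using assms by (simp add: \<delta>_def)
  \<comment> \<open>Chebyshev's product in expanded form, so that its integral is a combination of
    moments. As c is the mean for \<kappa>, the part carrying exp(-\<delta>/c) integrates to
    0.\<close>
  define g where "g = (\<lambda>y. (kern \<kappa>' 2 y - c * kern \<kappa>' 3 y) - exp (- \<delta> / c) * (kern \<kappa> 2 y - c * kern \<kappa> 3 y))"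
  have cont: "continuous_on {-1..1} g"
    unfolding g_def using assms by (auto intro!: continuous_intros continuous_kern)
  have g: "g y = kern \<kappa> 3 y * ((semi y - c) * (exp (- \<delta> / semi y) - exp (- \<delta> / c)))" for y
  proof (cases "semi y \<le> 0")
    case False
    have "exp (- \<kappa>' / semi y) = exp (- \<kappa> / semi y) * exp (- \<delta> / semi y)"
      by (simp add: \<delta>_def mult_exp_exp diff_divide_distrib)
    then have "kern \<kappa>' j y = kern \<kappa> j y * exp (- \<delta> / semi y)" for j
      by (simp add: kern_def)
    moreover have "kern \<kappa> 2 y = semi y * kern \<kappa> 3 y"
      using semi_mult_kern[of y \<kappa> 2] by (simp add: numeral_3_eq_3 numeral_2_eq_2)
    ultimately show ?thesis by (simp add: g_def algebra_simps)
  qed (simp add: g_def kern_def)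
  have sign: "(semi y - c) * (exp (- \<delta> / semi y) - exp (- \<delta> / c)) > 0" if "semi y \<noteq> c" "semi y > 0" for y
  proof (cases "semi y < c")
    case True
    then have "- \<delta> / semi y < - \<delta> / c" using that(2) \<delta>
      by (simp add: divide_strict_left_mono)
    then show ?thesis using True by (simp add: mult_neg_neg)
  next
    case False
    then have "- \<delta> / c < - \<delta> / semi y" using that c \<delta>
      by (simp add: divide_strict_left_mono)
    then show ?thesis using False that(1) by (simp)
  qed
  have nonneg: "g y \<ge> 0" for y
    using sign[of y] kern_nonneg[of \<kappa> 3 y] unfolding g
    by (cases "semi y \<le> 0"; cases "semi y = c") (auto simp: kern_def[of _ _ y] intro!: mult_nonneg_nonneg)
  have "\<not> (\<forall>y\<in>{-1..1}. g y = 0)"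
  proof
    assume *: "\<forall>y\<in>{-1..1}. g y = 0"
    have "semi y = c" if "\<bar>y\<bar> < 1" for y
    proof (rule ccontr)
      assume "semi y \<noteq> c"
      then have "g y > 0"
        unfolding g using sign[of y] that by (intro mult_pos_pos[OF kern_pos]) (auto simp: semi_pos_iff)
      then show False using * that by (auto simp: abs_less_iff)
    qed
    \<comment> \<open>\<open>semi\<close> takes different values at 0 and 1/2, so it is not
      constantly c; this is what makes the inequality strict.\<close>
    from this[of 0] this[of "1/2"] show False by (simp add: semi_def)
  qed
  then have "integral {-1..1} g \<noteq> 0"
    using integral_eq_0_iff[OF cont] nonneg by simp
  moreover have "integral {-1..1} g \<ge> 0"
    using nonneg by (intro integral_nonneg integrable_continuous_real cont) auto
  moreover have "integral {-1..1} g = (moment \<kappa>' 2 - c * moment \<kappa>' 3) - exp (- \<delta> / c) * (moment \<kappa> 2 - c * moment \<kappa> 3)"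
    unfolding g_def using \<kappa>' assms(1)
    by (intro integral_unique has_integral_diff has_integral_mult_right has_integral_kern)
  moreover have "moment \<kappa> 2 - c * moment \<kappa> 3 = 0"
    using pos by (simp add: c_def mean_semi_def)
  ultimately have "c * moment \<kappa>' 3 < moment \<kappa>' 2" by simp
  then show ?thesis
    using pos by (simp add: c_def[symmetric] mean_semi_def[of \<kappa>'] less_divide_eq)
qed

text \<open>The threshold is the supremum of the parameters with mean below c. The upper bound near
  0 makes this set nonempty, the lower bound makes it bounded, and strict monotonicity settles both
  sides of the supremum.\<close>

lemma mean_semi_threshold:
  assumes "0 < c" "c < 1"
  shows "\<exists>k>0. (\<forall>\<kappa>\<in>{0<..<k}. mean_semi \<kappa> < c) \<and> (\<forall>\<kappa>\<in>{k<..}. mean_semi \<kappa> > c)"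
proof -
  define S where "S = {\<kappa>. 0 < \<kappa> \<and> mean_semi \<kappa> < c}"
  have M: "moment 1 0 > 0" by (rule moment_pos) simp
  \<comment> \<open>This A makes the first term of the upper bound c/2; the choice of
    \<open>k0\<close> below keeps the second one at most c/4.\<close>
  define A where "A = 2 / c"
  have A: "A > 0" "1 / A = c / 2" using assms by (auto simp: A_def)
  define k0 where "k0 = min 1 (c * moment 1 0 / (8 * A\<^sup>2))"
  have k0: "0 < k0" "k0 \<le> 1" "k0 \<le> c * moment 1 0 / (8 * A\<^sup>2)"
    using A(1) M assms by (auto simp: k0_def)
  have "2 * A\<^sup>2 * k0 / moment 1 0 \<le> c / 4"
    using k0(3) A(1) M by (simp add: field_simps)
  then have "mean_semi k0 < c"
    using mean_semi_le[OF k0(1,2) A(1)] A(2) assms(1) by linarith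
  then have k0S: "k0 \<in> S" using k0 by (simp add: S_def)
  have bound: "\<kappa> \<le> c / (1 - c)" if "\<kappa> \<in> S" for \<kappa>
  proof -
    have "\<kappa> / (\<kappa> + 1) < c" "\<kappa> > 0" using that mean_semi_ge[of \<kappa>] by (auto simp: S_def)
    then have "\<kappa> < c * (\<kappa> + 1)" by (simp add: field_simps)
    then show ?thesis using assms by (simp add: field_simps)
  qed
  then have bdd: "bdd_above S" by (auto simp: bdd_above_def)
  have "Sup S > 0" using cSup_upper[OF k0S bdd] k0(1) by linarith
  moreover have "mean_semi \<kappa> < c" if "0 < \<kappa>" "\<kappa> < Sup S" for \<kappa>
  proof -
    from that(2) obtain \<kappa>' where "\<kappa>' \<in> S" "\<kappa> < \<kappa>'"
      using k0S bdd less_cSup_iff by blast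
    then show ?thesis using mean_semi_strict_mono[of \<kappa> \<kappa>'] that(1) by (auto simp: S_def)
  qed
  moreover have "mean_semi \<kappa> > c" if "Sup S < \<kappa>" for \<kappa>
  proof -
    \<comment> \<open>At \<open>\<kappa>'\<close> the mean is only known to be at least c; a point
      strictly to its right upgrades this to a strict inequality.\<close>
    from dense[OF that] obtain \<kappa>' where "Sup S < \<kappa>'" "\<kappa>' < \<kappa>" by blast
    then have "\<kappa>' \<notin> S" "\<kappa>' > 0" using cSup_upper[OF _ bdd] \<open>Sup S > 0\<close> by force+
    then show ?thesis using mean_semi_strict_mono[of \<kappa>' \<kappa>] \<open>\<kappa>' < \<kappa>\<close> by (auto simp: S_def)
  qed
  ultimately show ?thesis by (intro exI[of _ "Sup S"]) auto
qed

subsection \<open>Invariance and the generator\<close>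

lemma angular_rate_0: "angular_rate b 0 \<theta> = - 2 * b * (sin \<theta>)\<^sup>2"
  by (simp add: angular_rate_def switch_matrix_def unit_vec_def matrix_vector_mult_def inner_vec_def UNIV_2 sum_2 cos_add sin_add algebra_simps power2_eq_square)

lemma angular_rate_1: "angular_rate b (Suc 0) \<theta> = 2 * b * (cos \<theta>)\<^sup>2"
  by (simp add: angular_rate_def switch_matrix_def unit_vec_def matrix_vector_mult_def inner_vec_def UNIV_2 sum_2 cos_add sin_add algebra_simps power2_eq_square)

text \<open>The value does not depend on the mode i, so the growth exponent sees only the angular
  marginal of the invariant measure.\<close>

lemma radial_rate: "radial_rate b (\<theta>, i) = - 1 + b * sin (2 * \<theta>)"
proof -
  have "cos \<theta> * cos \<theta> + sin \<theta> * sin \<theta> = 1"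
    using sin_cos_squared_add[of \<theta>] by (simp add: power2_eq_square)
  then have "- (cos \<theta> * cos \<theta>) - sin \<theta> * sin \<theta> = - 1" by linarith
  then show ?thesis
    unfolding radial_rate_def switch_matrix_def unit_vec_def matrix_vector_mult_def inner_vec_def sin_double
    by (simp add: sum_2 algebra_simps)
qed

section \<open>Measurability and integrability of functions continuous on the circle\<close>

lemma measurable_state_space:
  fixes g :: "real \<times> nat \<Rightarrow> real"
  assumes "\<And>i. i \<in> {0, 1} \<Longrightarrow> continuous_on UNIV (\<lambda>\<theta>. g (\<theta>, i))"
  shows "g \<in> borel_measurable state_space"
proof -
  have "(\<lambda>x. g (fst x, snd x)) \<in> borel_measurable state_space"
    unfolding state_space_def
  proof (rule measurable_compose_countable'[where f="\<lambda>i x. g (fst x, i)" and g=snd and I="{0, 1}"])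
    fix i :: nat assume "i \<in> {0, 1}"
    then have "(\<lambda>\<theta>. g (\<theta>, i)) \<in> borel_measurable (restrict_space borel {0..<2 * pi})"
      by (intro measurable_restrict_space1 borel_measurable_continuous_onI assms)
    then show "(\<lambda>x. g (fst x, i)) \<in> borel_measurable (restrict_space borel {0..<2 * pi} \<Otimes>\<^sub>M count_space {0, 1})"
      by (rule measurable_compose[OF measurable_fst])
  qed auto
  then show ?thesis by simp
qed

lemma space_state_space: "space state_space = {0..<2 * pi} \<times> {0, 1}"
  by (simp add: state_space_def space_pair_measure space_restrict_space)

text \<open>The half-open interval is not compact; the bound is taken on its closure, where
  continuity on the whole line applies.\<close>

lemma bounded_state_space:
  fixes g :: "real \<times> nat \<Rightarrow> real"
  assumes "\<And>i. i \<in> {0, 1} \<Longrightarrow> continuous_on UNIV (\<lambda>\<theta>. g (\<theta>, i))"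
  obtains B where "\<And>x. x \<in> space state_space \<Longrightarrow> \<bar>g x\<bar> \<le> B"
proof -
  have "\<exists>B. \<forall>\<theta>\<in>{0..2 * pi}. \<bar>g (\<theta>, i)\<bar> \<le> B" if "i \<in> {0, 1}" for i
  proof -
    have "compact ((\<lambda>\<theta>. g (\<theta>, i)) ` {0..2 * pi})"
      by (intro compact_continuous_image continuous_on_subset[OF assms[OF that]]) auto
    then show ?thesis
      by (auto dest!: compact_imp_bounded simp: bounded_iff)
  qed
  from this[of 0] this[of 1] obtain B0 B1 where
    "\<forall>\<theta>\<in>{0..2 * pi}. \<bar>g (\<theta>, 0)\<bar> \<le> B0" "\<forall>\<theta>\<in>{0..2 * pi}. \<bar>g (\<theta>, 1)\<bar> \<le> B1"
    by auto
  then have "\<bar>g x\<bar> \<le> max B0 B1" if "x \<in> space state_space" for x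
    using that by (fastforce simp: space_state_space le_max_iff_disj)
  then show thesis by (rule that)
qed

lemma integrable_state_space:
  fixes g :: "real \<times> nat \<Rightarrow> real"
  assumes "finite_measure M" and "sets M = sets state_space"
    and "\<And>i. i \<in> {0, 1} \<Longrightarrow> continuous_on UNIV (\<lambda>\<theta>. g (\<theta>, i))"
  shows "integrable M g"
proof -
  interpret finite_measure M by fact
  obtain B where B: "\<And>x. x \<in> space state_space \<Longrightarrow> \<bar>g x\<bar> \<le> B"
    using bounded_state_space assms(3) by blast
  have "g \<in> borel_measurable M"
    using measurable_state_space[of g] assms(3) by (simp cong: measurable_cong_sets add: assms(2))
  moreover have "AE x in M. norm (g x) \<le> B"
    using B sets_eq_imp_space_eq[OF assms(2)] by (intro AE_I2) simp
  ultimately show ?thesis by (intro integrable_const_bound[where B=B])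
qed

lemma C1_circle_continuous:
  assumes "f \<in> C1_circle" "i \<in> {0, 1}"
  shows "continuous_on UNIV (\<lambda>\<theta>. f (\<theta>, i))"
  using assms by (intro C1_differentiable_imp_continuous_on) (auto simp: C1_circle_def)

lemma gen_L_continuous:
  assumes "f \<in> C1_circle" "i \<in> {0, 1}"
  shows "continuous_on UNIV (\<lambda>\<theta>. gen_L b \<beta> f (\<theta>, i))"
proof -
  obtain D where D: "\<And>\<theta>. ((\<lambda>\<theta>. f (\<theta>, i)) has_vector_derivative D \<theta>) (at \<theta>)"
    and cD: "continuous_on UNIV D"
    using assms by (auto simp: C1_circle_def C1_differentiable_on_def)
  then have "deriv (\<lambda>s. f (s, i)) = D"
    by (auto intro!: ext DERIV_imp_deriv simp: has_real_derivative_iff_has_vector_derivative)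
  moreover have "continuous_on UNIV (angular_rate b i)"
    using assms(2) by (auto intro!: continuous_intros simp: angular_rate_0 angular_rate_1)
  moreover have "continuous_on UNIV (\<lambda>\<theta>. f (\<theta>, 1 - i))"
    using assms(2) by (intro C1_circle_continuous[OF assms(1)]) auto
  ultimately show ?thesis
    using cD C1_circle_continuous[OF assms] unfolding gen_L_def
    by (auto intro!: continuous_intros)
qed

text \<open>By invariance the difference quotients of the semigroup have mean 0. They converge
  uniformly to \<open>gen_L b \<beta> f\<close>, and uniform limits pass through a probability
  integral.\<close>

lemma integral_gen_L_eq_0:
  assumes proc: "angular_process b \<beta> P" and inv: "invariant_prob state_space P \<mu>"
    and f: "f \<in> C1_circle"
  shows "(\<integral>x. gen_L b \<beta> f x \<partial>\<mu>) = 0"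
proof -
  have sets: "sets \<mu> = sets state_space" and "prob_space \<mu>"
    and bind: "\<And>t. t \<ge> 0 \<Longrightarrow> \<mu> \<bind> P t = \<mu>"
    using inv by (auto simp: invariant_prob_def space_prob_algebra)
  then interpret prob_space \<mu> by simp
  have space: "space \<mu> = space state_space" using sets by (rule sets_eq_imp_space_eq)
  have P: "P t \<in> \<mu> \<rightarrow>\<^sub>M prob_algebra state_space" if "t \<ge> 0" for t
    using proc that sets by (simp add: angular_process_def markov_semigroup_def cong: measurable_cong_sets)
  obtain B where B: "\<And>x. x \<in> space state_space \<Longrightarrow> \<bar>f x\<bar> \<le> B"
    using bounded_state_space C1_circle_continuous[OF f] by blast
  have fm: "f \<in> borel_measurable state_space"
    using C1_circle_continuous[OF f] by (rule measurable_state_space)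
  have intf: "integrable \<mu> f"
    using C1_circle_continuous[OF f] sets by (intro integrable_state_space) unfold_locales
  have intL: "integrable \<mu> (gen_L b \<beta> f)"
    using gen_L_continuous[OF f] sets by (intro integrable_state_space) unfold_locales
  have Pm: "(\<lambda>x. \<integral>y. f y \<partial>P t x) \<in> borel_measurable \<mu>" if "t \<ge> 0" for t
    using measurable_compose[OF measurable_prob_algebraD[OF P[OF that]] integral_measurable_subprob_algebra[OF fm]] .
  have PB: "\<bar>\<integral>y. f y \<partial>P t x\<bar> \<le> B" if "t \<ge> 0" "x \<in> space \<mu>" for t x
  proof -
    have "P t x \<in> space (prob_algebra state_space)" using P[OF that(1)] that(2) by (rule measurable_space)
    then interpret Q: prob_space "P t x" by (simp add: space_prob_algebra)
    have s: "sets (P t x) = sets state_space"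
      using \<open>P t x \<in> _\<close> by (simp add: space_prob_algebra)
    have "integrable (P t x) f"
      using C1_circle_continuous[OF f] s by (intro integrable_state_space) unfold_locales
    then have "\<bar>\<integral>y. f y \<partial>P t x\<bar> \<le> (\<integral>y. \<bar>f y\<bar> \<partial>P t x)" by (intro integral_abs_bound)
    also have "\<dots> \<le> B"
      using \<open>integrable (P t x) f\<close> B sets_eq_imp_space_eq[OF s] by (intro Q.integral_le_const) auto
    finally show ?thesis .
  qed
  have intP: "integrable \<mu> (\<lambda>x. \<integral>y. f y \<partial>P t x)" if "t \<ge> 0" for t
    using PB[OF that] Pm[OF that] by (intro integrable_const_bound[where B=B]) auto
  have zero: "(\<integral>x. ((\<integral>y. f y \<partial>P t x) - f x) / t \<partial>\<mu>) = 0" if "t \<ge> 0" for t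
  proof -
    have "(\<integral>x. f x \<partial>(\<mu> \<bind> P t)) = (\<integral>x. \<integral>y. f y \<partial>P t x \<partial>\<mu>)"
    proof (rule integral_bind[where K=state_space and B=B and B'=1])
      show "P t \<in> \<mu> \<rightarrow>\<^sub>M subprob_algebra state_space" using measurable_prob_algebraD P that by blast
      show "AE x in \<mu>. emeasure (P t x) (space (P t x)) \<le> ennreal 1"
      proof (rule AE_I2)
        fix x assume "x \<in> space \<mu>"
        then have "P t x \<in> space (prob_algebra state_space)" using P[OF that] by (simp add: measurable_space)
        then interpret Q: prob_space "P t x" by (simp add: space_prob_algebra)
        show "emeasure (P t x) (space (P t x)) \<le> ennreal 1" by (simp add: Q.emeasure_space_1)
      qed
    qed (use fm B in \<open>auto, unfold_locales\<close>)
    then show ?thesis using bind[OF that] intP[OF that] intf by simp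
  qed
  have ul: "uniform_limit (space state_space)
        (\<lambda>t x. ((\<integral>y. f y \<partial>P t x) - f x) / t) (gen_L b \<beta> f) (at_right 0)"
    using proc f by (simp add: angular_process_def)
  \<comment> \<open>One small time t suffices for each e: the quotient at t has mean 0 and differs
    from the generator by less than e everywhere.\<close>
  have "\<bar>\<integral>x. gen_L b \<beta> f x \<partial>\<mu>\<bar> \<le> e" if "e > 0" for e
  proof -
    have "\<forall>\<^sub>F t in at_right 0. t > 0 \<and> (\<forall>x\<in>space state_space. dist (((\<integral>y. f y \<partial>P t x) - f x) / t) (gen_L b \<beta> f x) < e)"
      using uniform_limitD[OF ul that] eventually_at_right_less[of 0] by eventually_elim auto
    then obtain t where t: "t > 0"
      "\<And>x. x \<in> space state_space \<Longrightarrow> dist (((\<integral>y. f y \<partial>P t x) - f x) / t) (gen_L b \<beta> f x) < e"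
      using eventually_happens'[OF trivial_limit_at_right_real] by blast
    let ?h = "\<lambda>x. gen_L b \<beta> f x - ((\<integral>y. f y \<partial>P t x) - f x) / t"
    have int: "integrable \<mu> (\<lambda>x. ((\<integral>y. f y \<partial>P t x) - f x) / t)"
      using intP intf t(1) by auto
    have "(\<integral>x. gen_L b \<beta> f x \<partial>\<mu>) = (\<integral>x. ?h x \<partial>\<mu>)"
      using zero[of t] t(1) int intL by simp
    also have "\<bar>\<dots>\<bar> \<le> (\<integral>x. \<bar>?h x\<bar> \<partial>\<mu>)" by (rule integral_abs_bound)
    also have "\<dots> \<le> e"
      using int intL t(2) space by (intro integral_le_const) (auto simp: dist_real_def abs_minus_commute less_imp_le)
    finally show ?thesis .
  qed
  then show ?thesis
    by (metis abs_le_zero_iff dense_ge)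
qed

subsection \<open>The Poisson equation and the invariant measure\<close>

text \<open>This turns functions of y = cos 2\<theta> into test functions. The derivatives at y = -1
  and y = 1 are two-sided, so that the chain rule also holds at the angles where cos 2\<theta>
  attains these values.\<close>

lemma C1_circle_cos:
  assumes "\<And>i y. \<bar>y\<bar> \<le> 1 \<Longrightarrow> (F i has_real_derivative g i y) (at y)"
    and "\<And>i. continuous_on {-1..1} (g i)"
  shows "(\<lambda>(\<theta>, i). F i (cos (2 * \<theta>))) \<in> C1_circle"
    and "deriv (\<lambda>\<theta>. F i (cos (2 * \<theta>))) \<theta> = - 2 * sin (2 * \<theta>) * g i (cos (2 * \<theta>))"
proof -
  have D: "((\<lambda>\<theta>. F i (cos (2 * \<theta>))) has_real_derivative - 2 * sin (2 * \<theta>) * g i (cos (2 * \<theta>))) (at \<theta>)" for i \<theta>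
    by (rule DERIV_cong[OF DERIV_chain2[OF assms(1)]]) (auto intro!: derivative_eq_intros)
  then show "deriv (\<lambda>\<theta>. F i (cos (2 * \<theta>))) \<theta> = - 2 * sin (2 * \<theta>) * g i (cos (2 * \<theta>))"
    by (rule DERIV_imp_deriv)
  have "continuous_on UNIV (\<lambda>\<theta>. - 2 * sin (2 * \<theta>) * g i (cos (2 * \<theta>)))" for i
    by (intro continuous_intros continuous_on_compose2[OF assms(2)[of i]]) auto
  then have "(\<lambda>\<theta>. F i (cos (2 * \<theta>))) C1_differentiable_on UNIV" for i
    using D[of i] unfolding C1_differentiable_on_def has_real_derivative_iff_has_vector_derivative
    by (intro exI[of _ "\<lambda>\<theta>. - 2 * sin (2 * \<theta>) * g i (cos (2 * \<theta>))"]) simp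
  moreover have "cos (2 * (\<theta> + 2 * pi)) = cos (2 * \<theta>)" for \<theta> :: real
  proof -
    have "cos (2 * (\<theta> + 2 * pi)) = cos ((2 * \<theta> + 2 * pi) + 2 * pi)" by (simp add: algebra_simps)
    then show ?thesis by (simp only: cos_periodic)
  qed
  ultimately show "(\<lambda>(\<theta>, i). F i (cos (2 * \<theta>))) \<in> C1_circle"
    by (simp add: C1_circle_def)
qed

text \<open>The two open sets (-1, 1) and {|y| > z} cover the line. The lemma serves quotients whose
  denominators vanish at the endpoints while the numerators are 0 nearby.\<close>

lemma continuous_on_extend_by_0:
  fixes h :: "real \<Rightarrow> real"
  assumes "z < 1" and cont: "continuous_on {-1<..<1} h" and zero: "\<And>y. z \<le> \<bar>y\<bar> \<Longrightarrow> h y = 0"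
  shows "continuous_on UNIV h"
proof -
  have "continuous_on ({-1<..<1} \<union> {y. z < \<bar>y\<bar>}) h"
  proof (rule continuous_on_open_Un)
    show "open {y::real. z < \<bar>y\<bar>}" by (intro open_Collect_less continuous_intros)
    show "continuous_on {y. z < \<bar>y\<bar>} h"
      by (rule continuous_on_eq[of _ "\<lambda>_. 0"]) (auto simp: zero)
  qed (use cont in auto)
  moreover have "{-1<..<1} \<union> {y. z < \<bar>y\<bar>} = UNIV" using assms(1) by (auto simp: abs_less_iff)
  ultimately show ?thesis by simp
qed

lemma antiderivative_at:
  fixes h :: "real \<Rightarrow> real"
  assumes "continuous_on {a..c} h" "a < y" "y < c"
  shows "((\<lambda>u. integral {a..u} h) has_real_derivative h y) (at y)"
  using integral_has_real_derivative[OF assms(1), of y] at_within_Icc_at[of a y c] assms by simp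

text \<open>The difference \<open>D = F\<^sub>1 - F\<^sub>0\<close> solves the linear equation
  \<open>D' = - w / (b s\<^sup>3) + \<kappa> y D / s\<^sup>3\<close>; \<open>w\<close> being centred makes \<open>D\<close> vanish near both endpoints,
  so that the \<open>F\<^sub>i\<close> are constant there.\<close>

lemma poisson_equation:
  fixes w :: "real \<Rightarrow> real"
  assumes b: "b > 0" and \<beta>: "\<beta> > 0"
    and w: "continuous_on UNIV w" "z < 1" "\<And>y. z \<le> \<bar>y\<bar> \<Longrightarrow> w y = 0"
    and centred: "integral {-1..1} (\<lambda>y. w y * kern (\<beta> / (2 * b)) 3 y) = 0"
  shows "\<exists>F g :: nat \<Rightarrow> real \<Rightarrow> real.
    (\<forall>i y. \<bar>y\<bar> \<le> 1 \<longrightarrow> (F i has_real_derivative g i y) (at y)) \<and>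
    (\<forall>i. continuous_on {-1..1} (g i)) \<and>
    (\<forall>y. \<bar>y\<bar> < 1 \<longrightarrow>
      2 * b * (1 - y) * semi y * g 0 y + \<beta> / 2 * (F 1 y - F 0 y) = w y \<and>
      - 2 * b * (1 + y) * semi y * g 1 y + \<beta> / 2 * (F 0 y - F 1 y) = w y)"
proof -
  define \<kappa> where "\<kappa> = \<beta> / (2 * b)"
  have \<kappa>: "\<kappa> > 0" using b \<beta> by (simp add: \<kappa>_def)
  define p where "p = (\<lambda>y. w y * kern \<kappa> 3 y)"
  define \<Phi> where "\<Phi> = (\<lambda>y. integral {-1..y} p)"
  have cp: "continuous_on A p" for A
    unfolding p_def by (intro continuous_intros continuous_on_subset[OF w(1)] continuous_kern \<kappa>) auto
  have \<Phi>': "(\<Phi> has_real_derivative p y) (at y)" if "\<bar>y\<bar> < 1" for y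
    unfolding \<Phi>_def using that by (intro antiderivative_at[of _ 1] cp) auto
  \<comment> \<open>Near -1 the integrand is 0 on the whole range of integration. Near 1 the
    integral equals the total one, which is 0 by centring.\<close>
  have \<Phi>0: "\<Phi> y = 0" if "\<bar>y\<bar> < 1" "z \<le> \<bar>y\<bar>" for y
  proof (cases "y \<ge> 0")
    case True
    have "integral {y..1} p = 0"
      using True that by (intro integral_unique has_integral_is_0) (auto simp: p_def w(3))
    moreover have "integral {-1..y} p + integral {y..1} p = integral {-1..1} p"
      using that by (intro Henstock_Kurzweil_Integration.integral_combine integrable_continuous_real cp) auto
    ultimately show ?thesis using centred by (simp add: \<Phi>_def p_def \<kappa>_def)
  next
    case False
    then show ?thesis
      unfolding \<Phi>_def using that by (intro integral_unique has_integral_is_0) (auto simp: p_def w(3))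
  qed
  \<comment> \<open>Variation of constants: exp(\<kappa>/s) solves the homogeneous equation and
    \<Phi> supplies the source term.\<close>
  define D where "D = (\<lambda>y. if \<bar>y\<bar> < 1 then - exp (\<kappa> / semi y) * \<Phi> y / b else 0)"
  define D' where "D' = (\<lambda>y. - w y / (b * semi y ^ 3) + \<kappa> * y / semi y ^ 3 * D y)"
  \<comment> \<open>Obtained by solving the equation of mode 1 for the derivative of its
    unknown.\<close>
  define g1 where "g1 = (\<lambda>y. - (w y + \<beta> / 2 * D y) / (2 * b * (1 + y) * semi y))"
  \<comment> \<open>Starting at -2 keeps -1 in the interior of the interval, as a two-sided
    derivative there requires.\<close>
  define F1 where "F1 = (\<lambda>y. integral {-2..y} g1)"
  have D0: "D y = 0" if "z \<le> \<bar>y\<bar>" for y using \<Phi>0 that by (auto simp: D_def)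
  have D_deriv: "(D has_real_derivative D' y) (at y)" for y
  proof (cases "\<bar>y\<bar> < 1")
    case True
    then have s: "semi y > 0" by (simp add: semi_pos_iff)
    have ev: "\<forall>\<^sub>F x in nhds y. - exp (\<kappa> / semi x) * \<Phi> x / b = D x"
    proof (rule eventually_mono)
      show "\<forall>\<^sub>F x in nhds y. x \<in> {-1<..<1}" using True by (intro eventually_nhds_in_open) auto
    qed (auto simp: D_def abs_less_iff)
    have "exp (\<kappa> / semi y) * exp (- \<kappa> / semi y) = 1"
      by (simp add: exp_minus_inverse)
    then have e1: "exp (\<kappa> / semi y) * p y = w y / semi y ^ 3"
      using s by (simp add: p_def kern_def)
    have "((\<lambda>x. exp (\<kappa> / semi x)) has_real_derivative exp (\<kappa> / semi y) * (\<kappa> * y / semi y ^ 3)) (at y)"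
      using s by (auto intro!: derivative_eq_intros semi_has_real_derivative True simp: power2_eq_square power3_eq_cube)
    note DERIV_cdivide[OF DERIV_mult[OF DERIV_minus[OF this] \<Phi>'[OF True]], of b]
    moreover have "(- (exp (\<kappa> / semi y) * (\<kappa> * y / semi y ^ 3)) * \<Phi> y + p y * - exp (\<kappa> / semi y)) / b = D' y"
    proof -
      have "p y * - exp (\<kappa> / semi y) = - w y / semi y ^ 3" using e1 by (simp add: mult.commute)
      then show ?thesis
        using True by (simp add: D'_def D_def add_divide_distrib diff_divide_distrib mult_ac)
    qed
    ultimately have "((\<lambda>x. - exp (\<kappa> / semi x) * \<Phi> x / b) has_real_derivative D' y) (at y)" by simp
    then show ?thesis using DERIV_cong_ev[OF refl ev refl] by simp
  next
    case False
    have ev: "\<forall>\<^sub>F x in nhds y. 0 = D x"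
    proof (rule eventually_mono)
      show "\<forall>\<^sub>F x in nhds y. x \<in> {x. z < \<bar>x\<bar>}"
        using False w(2) by (intro eventually_nhds_in_open open_Collect_less continuous_intros) auto
    qed (auto simp: D0)
    have "D' y = 0" using False w(2) by (simp add: D'_def D0 w(3))
    then show ?thesis
      using DERIV_cong_ev[OF refl ev refl, THEN iffD1, OF DERIV_const] by simp
  qed
  have cD: "continuous_on A D" for A
    using D_deriv by (intro DERIV_continuous_on) (auto intro: has_field_derivative_at_within)
  have semi_neq: "semi y \<noteq> 0" if "y \<in> {-1<..<1}" for y
    using that semi_pos_iff[of y] by auto
  have cD': "continuous_on UNIV D'"
    unfolding D'_def
    by (rule continuous_on_extend_by_0[OF w(2)])
      (use b semi_neq in \<open>auto intro!: continuous_intros cD continuous_on_subset[OF w(1)] simp: w(3) D0\<close>)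
  have cg1: "continuous_on UNIV g1"
    unfolding g1_def
    by (rule continuous_on_extend_by_0[OF w(2)])
      (use b semi_neq in \<open>auto intro!: continuous_intros cD continuous_on_subset[OF w(1)] simp: w(3) D0\<close>)
  have F1_deriv: "(F1 has_real_derivative g1 y) (at y)" if "\<bar>y\<bar> \<le> 1" for y
    unfolding F1_def using that
    by (intro antiderivative_at[of _ 2] continuous_on_subset[OF cg1]) auto
  \<comment> \<open>The equation of mode 1 holds by the choice of \<open>g1\<close>; that of mode 0
    follows from the equation for D and s^2 = (1 + y)(1 - y).\<close>
  have eqs: "2 * b * (1 - y) * semi y * (g1 y - D' y) + \<beta> / 2 * D y = w y"
    "- 2 * b * (1 + y) * semi y * g1 y + \<beta> / 2 * - D y = w y" if y: "\<bar>y\<bar> < 1" for y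
  proof -
    have s: "semi y > 0" "1 + y > 0" "1 - y > 0" and s2: "semi y ^ 2 = (1 + y) * (1 - y)"
      using y semi_squared[of y] by (auto simp: semi_pos_iff algebra_simps power2_eq_square)
    have e: "2 * b * (1 + y) * semi y * g1 y = - (w y + \<beta> / 2 * D y)"
      using s b by (simp add: g1_def)
    then show "- 2 * b * (1 + y) * semi y * g1 y + \<beta> / 2 * - D y = w y" by simp
    have "semi y ^ 3 = (1 + y) * (1 - y) * semi y"
      using s2 by (simp add: power2_eq_square power3_eq_cube)
    \<comment> \<open>Here u and v stand for 1 + y and 1 - y, and 2 b \<kappa> = \<beta>.\<close>
    moreover have "2 * b * v * semi y * (- w y / (b * (u * v * semi y)) + \<kappa> * y / (u * v * semi y) * D y)
        = (- 2 * w y + \<beta> * y * D y) / u" if "u > 0" "v > 0" for u v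
      using that s(1) b by (simp add: \<kappa>_def field_simps)
    ultimately have D': "2 * b * (1 - y) * semi y * D' y = (- 2 * w y + \<beta> * y * D y) / (1 + y)"
      using s by (simp add: D'_def)
    have "2 * b * (1 - y) * semi y * g1 y = (1 - y) / (1 + y) * (2 * b * (1 + y) * semi y * g1 y)"
      using s by simp
    also have "\<dots> = - (1 - y) * (w y + \<beta> / 2 * D y) / (1 + y)"
      unfolding e by (simp only: minus_mult_left[symmetric] minus_mult_right[symmetric] times_divide_eq_left)
    finally have "2 * b * (1 - y) * semi y * (g1 y - D' y)
        = (- (1 - y) * (w y + \<beta> / 2 * D y) - (- 2 * w y + \<beta> * y * D y)) / (1 + y)"
      by (simp only: D' right_diff_distrib[of "2 * b * (1 - y) * semi y"] diff_divide_distrib)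
    also have "\<dots> = w y - \<beta> / 2 * D y"
      using s by (simp add: field_simps)
    finally have "2 * b * (1 - y) * semi y * (g1 y - D' y) = w y - \<beta> / 2 * D y" .
    then show "2 * b * (1 - y) * semi y * (g1 y - D' y) + \<beta> / 2 * D y = w y" by simp
  qed
  show ?thesis
  proof (rule exI[of _ "\<lambda>i y. F1 y - (if i = 0 then D y else 0)"],
      rule exI[of _ "\<lambda>i y. g1 y - (if i = 0 then D' y else 0)"], intro conjI allI impI)
    fix i :: nat and y :: real
    assume "\<bar>y\<bar> \<le> 1"
    then show "((\<lambda>y. F1 y - (if i = 0 then D y else 0)) has_real_derivative g1 y - (if i = 0 then D' y else 0)) (at y)"
      by (cases "i = 0") (auto intro!: DERIV_diff F1_deriv D_deriv)
  next
    fix i :: nat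
    show "continuous_on {-1..1} (\<lambda>y. g1 y - (if i = 0 then D' y else 0))"
      using continuous_on_subset[OF cg1] continuous_on_subset[OF cD']
      by (cases "i = 0") (auto intro!: continuous_on_diff)
  qed (use eqs in auto)
qed

section \<open>From the Poisson equation to the growth exponent\<close>

lemma semi_cos: "0 \<le> \<theta> \<Longrightarrow> \<theta> \<le> pi / 2 \<Longrightarrow> semi (cos (2 * \<theta>)) = sin (2 * \<theta>)"
  by (simp add: semi_def sin_squared_eq[symmetric] sin_ge_zero)

lemma abs_cos_double_less_1:
  assumes "0 < \<theta>" "\<theta> < pi / 2"
  shows "\<bar>cos (2 * \<theta>)\<bar> < 1"
  using assms semi_pos_iff[of "cos (2 * \<theta>)"] semi_cos[of \<theta>] sin_gt_zero[of "2 * \<theta>"] by simp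

lemma AE_first_class:
  assumes inv: "invariant_prob state_space P \<mu>" and carried: "measure \<mu> first_class = 1"
  shows "AE x in \<mu>. x \<in> first_class"
proof -
  interpret prob_space \<mu> using inv by (simp add: invariant_prob_def space_prob_algebra)
  \<comment> \<open>A set outside the sigma-algebra would have \<open>measure\<close> 0 by
    convention, contradicting the value 1.\<close>
  have "first_class \<in> sets \<mu>" using carried measure_notin_sets by fastforce
  then show ?thesis using carried by (simp add: AE_in_set_eq_1)
qed

text \<open>The solution of the Poisson equation, read in y = cos 2\<theta>, is a test function
  whose image under the generator has mean 0. On the first class sin 2\<theta> equals
  \<open>semi (cos (2 * \<theta>))\<close>, so there this image is w(cos 2\<theta>).\<close>

lemma expectation_eq_0:
  fixes w :: "real \<Rightarrow> real"
  assumes proc: "angular_process b \<beta> P" and inv: "invariant_prob state_space P \<mu>"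
    and carried: "measure \<mu> first_class = 1"
    and b: "b > 0" and \<beta>: "\<beta> > 0"
    and w: "continuous_on UNIV w" "z < 1" "\<And>y. z \<le> \<bar>y\<bar> \<Longrightarrow> w y = 0"
    and centred: "integral {-1..1} (\<lambda>y. w y * kern (\<beta> / (2 * b)) 3 y) = 0"
  shows "(\<integral>x. w (cos (2 * fst x)) \<partial>\<mu>) = 0"
proof -
  have "prob_space \<mu>" and sets: "sets \<mu> = sets state_space"
    using inv by (auto simp: invariant_prob_def space_prob_algebra)
  then interpret prob_space \<mu> by simp
  obtain F g :: "nat \<Rightarrow> real \<Rightarrow> real" where
    Fg: "\<And>i y. \<bar>y\<bar> \<le> 1 \<Longrightarrow> (F i has_real_derivative g i y) (at y)" "\<And>i. continuous_on {-1..1} (g i)"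
    and eq0: "\<And>y. \<bar>y\<bar> < 1 \<Longrightarrow> 2 * b * (1 - y) * semi y * g 0 y + \<beta> / 2 * (F 1 y - F 0 y) = w y"
    and eq1: "\<And>y. \<bar>y\<bar> < 1 \<Longrightarrow> - 2 * b * (1 + y) * semi y * g 1 y + \<beta> / 2 * (F 0 y - F 1 y) = w y"
    using poisson_equation[OF b \<beta> w centred] by metis
  define f where "f = (\<lambda>(\<theta>, i). F i (cos (2 * \<theta>)))"
  have f: "f \<in> C1_circle" using C1_circle_cos(1)[of F g, OF Fg] by (simp add: f_def)
  have L: "gen_L b \<beta> f x = w (cos (2 * fst x))" if "x \<in> first_class" for x
  proof -
    obtain \<theta> i where x: "x = (\<theta>, i)" by (cases x)
    then have \<theta>: "0 < \<theta>" "\<theta> < pi / 2" and i: "i \<in> {0, 1}"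
      using that by (auto simp: first_class_def)
    let ?y = "cos (2 * \<theta>)"
    have y: "\<bar>?y\<bar> < 1" using \<theta> by (rule abs_cos_double_less_1)
    have s: "semi ?y = sin (2 * \<theta>)" using \<theta> by (simp add: semi_cos)
    have d: "deriv (\<lambda>\<theta>. f (\<theta>, i)) \<theta> = - 2 * semi ?y * g i ?y"
      unfolding f_def s by (simp add: C1_circle_cos(2)[of F g, OF Fg])
    have "angular_rate b 0 \<theta> = - b * (2 * (sin \<theta>)\<^sup>2)" "angular_rate b (Suc 0) \<theta> = b * (2 * (cos \<theta>)\<^sup>2)"
      by (simp_all add: angular_rate_0 angular_rate_1)
    moreover have "2 * (sin \<theta>)\<^sup>2 = 1 - ?y" "2 * (cos \<theta>)\<^sup>2 = 1 + ?y"
      using cos_double_sin[of \<theta>] cos_double_cos[of \<theta>] by simp_all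
    ultimately have r: "angular_rate b 0 \<theta> = - b * (1 - ?y)" "angular_rate b (Suc 0) \<theta> = b * (1 + ?y)"
      by simp_all
    from i consider "i = 0" | "i = Suc 0" by auto
    then show ?thesis
    proof cases
      case 1
      then show ?thesis using eq0[OF y] d
        by (simp add: x gen_L_def r) (simp add: f_def algebra_simps)
    next
      case 2
      then show ?thesis using eq1[OF y] d
        by (simp add: x gen_L_def r) (simp add: f_def algebra_simps)
    qed
  qed
  have "AE x in \<mu>. w (cos (2 * fst x)) = gen_L b \<beta> f x"
    using AE_first_class[OF inv carried] by eventually_elim (simp add: L)
  moreover have "(\<lambda>x. w (cos (2 * fst x))) \<in> borel_measurable \<mu>"
    by (intro borel_measurable_integrable integrable_state_space finite_measure_axioms sets)
      (auto intro!: continuous_intros continuous_on_compose2[OF w(1)])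
  moreover have "gen_L b \<beta> f \<in> borel_measurable \<mu>"
    by (intro borel_measurable_integrable integrable_state_space finite_measure_axioms sets
        gen_L_continuous[OF f])
  ultimately have "(\<integral>x. w (cos (2 * fst x)) \<partial>\<mu>) = (\<integral>x. gen_L b \<beta> f x \<partial>\<mu>)"
    by (intro integral_cong_AE)
  also have "\<dots> = 0" by (rule integral_gen_L_eq_0[OF proc inv f])
  finally show ?thesis .
qed

text \<open>The centred version of s does not vanish near the endpoints, so it is cut off first; the
  identity for the truncated functions then passes to the limit by dominated convergence on both
  sides.\<close>

lemma integral_sin_double:
  assumes proc: "angular_process b \<beta> P" and inv: "invariant_prob state_space P \<mu>"
    and carried: "measure \<mu> first_class = 1"
    and b: "b > 0" and \<beta>: "\<beta> > 0"
  shows "(\<integral>x. sin (2 * fst x) \<partial>\<mu>) = mean_semi (\<beta> / (2 * b))"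
proof -
  have "prob_space \<mu>" and sets: "sets \<mu> = sets state_space"
    using inv by (auto simp: invariant_prob_def space_prob_algebra)
  then interpret prob_space \<mu> by simp
  define \<kappa> where "\<kappa> = \<beta> / (2 * b)"
  have \<kappa>: "\<kappa> > 0" using b \<beta> by (simp add: \<kappa>_def)
  \<comment> \<open>The cutoff is 0 for s up to 1/(n+1) and 1 from s = 2/(n+1) on;
    \<open>Suc n\<close> keeps these fractions meaningful for n = 0.\<close>
  define \<eta> where "\<eta> = (\<lambda>n y. max 0 (min 1 (real (Suc n) * semi y - 1)))"
  define a where "a = (\<lambda>n j. integral {-1..1} (\<lambda>y. \<eta> n y * kern \<kappa> j y))"
  have c\<eta>: "continuous_on A (\<eta> n)" for n A
    unfolding \<eta>_def by (intro continuous_intros)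
  have \<eta>_le: "\<bar>\<eta> n y\<bar> \<le> 1" for n y by (auto simp: \<eta>_def)
  have \<eta>_lim: "(\<lambda>n. \<eta> n y) \<longlonglongrightarrow> 1" if "semi y > 0" for y
  proof (rule tendsto_eventually)
    obtain N where N: "2 / semi y \<le> real N" using real_arch_simple by blast
    have "\<eta> n y = 1" if "n \<ge> N" for n
    proof -
      have "2 / semi y \<le> real (Suc n)" using N that by linarith
      then have "2 \<le> real (Suc n) * semi y" using \<open>semi y > 0\<close> by (simp add: field_simps)
      then show ?thesis by (simp add: \<eta>_def)
    qed
    then show "\<forall>\<^sub>F n in sequentially. \<eta> n y = 1" by (auto simp: eventually_sequentially)
  qed
  have lim_a: "(\<lambda>n. a n j) \<longlonglongrightarrow> moment \<kappa> j" for j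
    unfolding a_def moment_def
  proof (rule dominated_convergence(2)[where h="kern \<kappa> j"])
    show "(\<lambda>y. \<eta> n y * kern \<kappa> j y) integrable_on {-1..1}" for n
      by (intro integrable_continuous_real continuous_intros c\<eta> continuous_kern \<kappa>)
    show "norm (\<eta> n y * kern \<kappa> j y) \<le> kern \<kappa> j y" for n y
      using \<eta>_le[of n y] kern_nonneg[of \<kappa> j y] by (simp add: abs_mult mult_left_le_one_le)
    show "(\<lambda>n. \<eta> n y * kern \<kappa> j y) \<longlonglongrightarrow> kern \<kappa> j y" for y
    proof (cases "semi y > 0")
      case True
      then show ?thesis using tendsto_mult_right[OF \<eta>_lim[OF True], of "kern \<kappa> j y"] by simp
    qed (simp add: kern_def)
  qed (rule integrable_kern[OF \<kappa>])
  have balance: "a n 3 * (\<integral>x. \<eta> n (cos (2 * fst x)) * semi (cos (2 * fst x)) \<partial>\<mu>)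
      = a n 2 * (\<integral>x. \<eta> n (cos (2 * fst x)) \<partial>\<mu>)" for n
  proof -
    \<comment> \<open>The coefficients are the truncated moments themselves, which makes w exactly
      centred for each n.\<close>
    define w where "w = (\<lambda>y. a n 3 * (\<eta> n y * semi y) - a n 2 * \<eta> n y)"
    \<comment> \<open>On [-1, 1], |y| is at least z exactly when s is at most 1/(n+1).\<close>
    define z where "z = sqrt (1 - 1 / (real (Suc n))\<^sup>2)"
    have "z < 1" by (simp add: z_def)
    have "w y = 0" if "z \<le> \<bar>y\<bar>" for y
    proof -
      have "0 \<le> 1 - 1 / (real (Suc n))\<^sup>2" by (simp add: field_simps)
      moreover have "0 \<le> z" using calculation by (simp add: z_def)
      ultimately have "1 - 1 / (real (Suc n))\<^sup>2 \<le> y\<^sup>2"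
        using power_mono[OF that \<open>0 \<le> z\<close>, of 2] by (simp add: z_def)
      then have "semi y \<le> sqrt ((1 / real (Suc n))\<^sup>2)"
        unfolding semi_def by (intro real_sqrt_le_mono) (simp add: power_divide)
      then have "semi y \<le> 1 / real (Suc n)" by simp
      then have "real (Suc n) * semi y \<le> 1" by (simp add: field_simps)
      then show ?thesis by (simp add: w_def \<eta>_def)
    qed
    moreover have "continuous_on UNIV w"
      unfolding w_def by (intro continuous_intros c\<eta>)
    moreover have "integral {-1..1} (\<lambda>y. w y * kern (\<beta> / (2 * b)) 3 y) = 0"
    proof -
      have h: "((\<lambda>y. \<eta> n y * kern \<kappa> j y) has_integral a n j) {-1..1}" for j
        unfolding a_def
        by (intro integrable_integral integrable_continuous_real continuous_intros c\<eta> continuous_kern \<kappa>)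
      have "w y * kern (\<beta> / (2 * b)) 3 y = a n 3 * (\<eta> n y * kern \<kappa> 2 y) - a n 2 * (\<eta> n y * kern \<kappa> 3 y)" for y
        using semi_mult_kern[of y \<kappa> 2]
        by (simp add: w_def \<kappa>_def algebra_simps numeral_3_eq_3 numeral_2_eq_2)
      moreover have "((\<lambda>y. a n 3 * (\<eta> n y * kern \<kappa> 2 y) - a n 2 * (\<eta> n y * kern \<kappa> 3 y))
          has_integral a n 3 * a n 2 - a n 2 * a n 3) {-1..1}"
        by (intro has_integral_diff has_integral_mult_right h)
      ultimately show ?thesis by (simp add: integral_unique mult.commute)
    qed
    ultimately have "(\<integral>x. w (cos (2 * fst x)) \<partial>\<mu>) = 0"
      using expectation_eq_0[OF proc inv carried b \<beta>] \<open>z < 1\<close> by blast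
    moreover have "integrable \<mu> (\<lambda>x. \<eta> n (cos (2 * fst x)) * semi (cos (2 * fst x)))"
      "integrable \<mu> (\<lambda>x. \<eta> n (cos (2 * fst x)))"
      by (intro integrable_state_space finite_measure_axioms sets;
          auto intro!: continuous_intros continuous_on_compose2[OF c\<eta>[of UNIV]])+
    ultimately show ?thesis by (simp add: w_def)
  qed
  have fc: "AE x in \<mu>. 0 < fst x \<and> fst x < pi / 2"
    using AE_first_class[OF inv carried] by eventually_elim (auto simp: first_class_def)
  \<comment> \<open>Needed for g = 1 and for the function \<open>semi (cos (2 * \<theta>))\<close>;
    the constant 1 dominates.\<close>
  have lim1: "(\<lambda>n. \<integral>x. \<eta> n (cos (2 * fst x)) * g (fst x) \<partial>\<mu>) \<longlonglongrightarrow> (\<integral>x. g (fst x) \<partial>\<mu>)"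
    if g: "continuous_on UNIV g" and g1: "\<And>\<theta>. \<bar>g \<theta>\<bar> \<le> 1" for g :: "real \<Rightarrow> real"
  proof (rule integral_dominated_convergence[where w="\<lambda>_. 1"])
    show "AE x in \<mu>. (\<lambda>n. \<eta> n (cos (2 * fst x)) * g (fst x)) \<longlonglongrightarrow> g (fst x)"
      using fc
    proof eventually_elim
      case (elim x)
      then have "semi (cos (2 * fst x)) > 0" using abs_cos_double_less_1 by (simp add: semi_pos_iff)
      then show ?case using tendsto_mult_right[OF \<eta>_lim, of _ "g (fst x)"] by simp
    qed
    show "(\<lambda>x. \<eta> n (cos (2 * fst x)) * g (fst x)) \<in> borel_measurable \<mu>" for n
      by (intro borel_measurable_integrable integrable_state_space finite_measure_axioms sets)
        (auto intro!: continuous_intros continuous_on_compose2[OF c\<eta>[of UNIV]] continuous_on_subset[OF g])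
    show "(\<lambda>x. g (fst x)) \<in> borel_measurable \<mu>"
      by (intro borel_measurable_integrable integrable_state_space finite_measure_axioms sets)
        (auto intro!: continuous_on_subset[OF g])
    show "AE x in \<mu>. norm (\<eta> n (cos (2 * fst x)) * g (fst x)) \<le> 1" for n
      using \<eta>_le g1 by (auto simp: abs_mult intro!: mult_le_one)
  qed simp
  let ?S = "\<integral>x. semi (cos (2 * fst x)) \<partial>\<mu>"
  have "(\<lambda>n. a n 3 * (\<integral>x. \<eta> n (cos (2 * fst x)) * semi (cos (2 * fst x)) \<partial>\<mu>)) \<longlonglongrightarrow> moment \<kappa> 3 * ?S"
    using semi_le_1 semi_nonneg[of "cos _"]
    by (intro tendsto_mult lim_a lim1 continuous_intros) (auto simp: abs_le_iff intro: order_trans[of _ 0])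
  moreover have "(\<lambda>n. a n 2 * (\<integral>x. \<eta> n (cos (2 * fst x)) \<partial>\<mu>)) \<longlonglongrightarrow> moment \<kappa> 2 * 1"
    using lim1[of "\<lambda>_. 1"] by (intro tendsto_mult lim_a) (simp add: prob_space)
  ultimately have "moment \<kappa> 3 * ?S = moment \<kappa> 2"
    using LIMSEQ_unique by (simp add: balance)
  moreover have "?S = (\<integral>x. sin (2 * fst x) \<partial>\<mu>)"
  proof (rule integral_cong_AE)
    show "AE x in \<mu>. semi (cos (2 * fst x)) = sin (2 * fst x)"
      using fc by eventually_elim (simp add: semi_cos)
  qed (intro borel_measurable_integrable integrable_state_space finite_measure_axioms sets;
      auto intro!: continuous_intros)+
  ultimately have "(\<integral>x. sin (2 * fst x) \<partial>\<mu>) = mean_semi \<kappa>"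
    using moment_pos[OF \<kappa>, of 3] by (simp add: mean_semi_def field_simps)
  then show ?thesis by (simp add: \<kappa>_def)
qed

lemma growth_exponent_eq:
  assumes "angular_process b \<beta> P" and inv: "invariant_prob state_space P \<mu>"
    and "measure \<mu> first_class = 1" and "b > 0" and "\<beta> > 0"
  shows "growth_exponent b \<mu> = - 1 + b * mean_semi (\<beta> / (2 * b))"
proof -
  have "prob_space \<mu>" and sets: "sets \<mu> = sets state_space"
    using inv by (auto simp: invariant_prob_def space_prob_algebra)
  then interpret prob_space \<mu> by simp
  have "radial_rate b = (\<lambda>x. - 1 + b * sin (2 * fst x))"
    by (auto simp: fun_eq_iff radial_rate)
  moreover have "integrable \<mu> (\<lambda>x. sin (2 * fst x))"
    by (intro integrable_state_space finite_measure_axioms sets) (auto intro!: continuous_intros)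
  ultimately show ?thesis
    using integral_sin_double[OF assms] by (simp add: growth_exponent_def prob_space)
qed

theorem corollary3p5:
  fixes b :: real
    and P :: "real \<Rightarrow> real \<Rightarrow> real \<times> nat \<Rightarrow> (real \<times> nat) measure"
    and \<mu> :: "real \<Rightarrow> (real \<times> nat) measure"
    and chi :: "real \<Rightarrow> real"
  assumes "b > 0"
    and process: "\<And>\<beta>. \<beta> > 0 \<Longrightarrow> angular_process b \<beta> (P \<beta>)"
    and ergodic: "\<And>\<beta>. \<beta> > 0 \<Longrightarrow> ergodic_prob state_space (P \<beta>) (\<mu> \<beta>)"
    and carried: "\<And>\<beta>. \<beta> > 0 \<Longrightarrow> measure (\<mu> \<beta>) first_class = 1"
    and chi_def: "\<And>\<beta>. \<beta> > 0 \<Longrightarrow> chi \<beta> = growth_exponent b (\<mu> \<beta>)"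
    and "b > 1"
  shows "\<exists>\<beta>\<^sub>c>0. (\<forall>\<beta>\<in>{0<..<\<beta>\<^sub>c}. chi \<beta> < 0) \<and> (\<forall>\<beta>\<in>{\<beta>\<^sub>c<..}. chi \<beta> > 0)"
proof -
  have chi: "chi \<beta> = - 1 + b * mean_semi (\<beta> / (2 * b))" if "\<beta> > 0" for \<beta>
    unfolding chi_def[OF that]
    using growth_exponent_eq[OF process _ carried] ergodic that \<open>b > 0\<close>
    by (simp add: ergodic_prob_def)
  \<comment> \<open>The sign of chi is that of the mean minus 1/b, and b > 1 puts this level inside
    (0, 1). The critical rate is then recovered from \<kappa> = \<beta>/(2b).\<close>
  obtain k where "k > 0"
    and less: "\<And>\<kappa>. 0 < \<kappa> \<Longrightarrow> \<kappa> < k \<Longrightarrow> mean_semi \<kappa> < 1 / b"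
    and greater: "\<And>\<kappa>. k < \<kappa> \<Longrightarrow> mean_semi \<kappa> > 1 / b"
    using mean_semi_threshold[of "1 / b"] \<open>b > 1\<close> by auto
  show ?thesis
  proof (intro exI[of _ "2 * b * k"] conjI ballI)
    show "0 < 2 * b * k" using \<open>b > 0\<close> \<open>k > 0\<close> by simp
  next
    fix \<beta> assume "\<beta> \<in> {0<..<2 * b * k}"
    then have "0 < \<beta>" "\<beta> / (2 * b) < k" using \<open>b > 0\<close> by (auto simp: field_simps)
    then show "chi \<beta> < 0" using less[of "\<beta> / (2 * b)"] chi[of \<beta>] \<open>b > 0\<close> by (simp add: field_simps)
  next
    fix \<beta> assume "\<beta> \<in> {2 * b * k<..}"
    moreover have "0 < 2 * b * k" using \<open>b > 0\<close> \<open>k > 0\<close> by simp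
    ultimately have "0 < \<beta>" "k < \<beta> / (2 * b)" using \<open>b > 0\<close> by (auto simp: field_simps)
    then show "chi \<beta> > 0" using greater[of "\<beta> / (2 * b)"] chi[of \<beta>] \<open>b > 0\<close> by (simp add: field_simps)
  qed
qed

end
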